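(* Let $\mathcal H\subseteq\mathcal H_0$ be an arbitrary nonempty family of Borel-measurable subset selection rules $h:\mathbb R^\Lambda\to\{0,1\}^\Lambda$, and let $h^\star$ be the data-driven rule minimizing the penalized empirical risk over $\mathcal H$, $$h^\star=\arg\min_{h\in\mathcal H}\Big\{\|\hat f(h)-\tilde f\|^2+2\,Pen(h)\Big\}.$$ Then for every $\delta\in(0,1)$, $$\mathbf E_f\|\hat f(h^\star)-f\|^2\le(1+\delta)\,\mathbf E_f\Big[\inf_{h\in\mathcal H}\Big(\sum_{\lambda\in\Lambda}(1-h_\lambda)f_\lambda^2-\sum_{\lambda\in\Lambda}h_\lambda(X_\lambda^2-f_\lambda^2)+2\,Pen(h)\Big)\Big]+\Omega_\delta,$$ where $$\Omega_\delta:=4\sqrt2\,\min\big(\tfrac1n,\|\Sigma\|\big)+\frac2\delta\sum_{\lambda\in\Lambda}\min(f_\lambda^2,\sigma_\lambda^2).$$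
   Context: Let $\Lambda$ be a finite nonempty index set, $n=\#\Lambda$. One observes $X_\lambda=f_\lambda+\xi_\lambda$, $\lambda\in\Lambda$, where $(f_\lambda)_{\lambda\in\Lambda}\in\mathbb R^\Lambda$ is unknown and deterministic and $(\xi_\lambda)_{\lambda\in\Lambda}\sim\mathcal N(0,\Sigma)$ with $\Sigma=\mathrm{diag}(\sigma_\lambda^2)_{\lambda\in\Lambda}$, $\sigma_\lambda>0$. Write $X=(X_\lambda)_{\lambda\in\Lambda}$; $\mathbf E_f$ is expectation when the true parameter is $f$. $\|\Sigma\|=\max_\lambda\sigma_\lambda^2$ is the operator norm. Let $(\psi_\lambda)_{\lambda\in\Lambda}$ be an orthonormal system in $L^2$, $f=\sum_{\lambda\in\Lambda}f_\lambda\psi_\lambda$, $\tilde f=\sum_{\lambda\in\Lambda}X_\lambda\psi_\lambda$, and for $h\in\{0,1\}^\Lambda$ let $\hat f(h)=\sum_{\lambda\in\Lambda}h_\lambda X_\lambda\psi_\lambda$. The norm of a function is the $L^2$ norm, i.e. the Euclidean norm of the coefficient vector in $\mathbb R^\Lambda$. $\mathcal H_0$ is the set of all Borel-measurable maps $h:\mathbb R^\Lambda\to\{0,1\}^\Lambda$ (data-driven subset selection rules). For a rule $h$, wherever $h$, $h_\lambda$, $\hat f(h)$, $Pen(h)$ occur in expressions involving the data, $h$ means the (random) value $h(X)$. For $h\in\{0,1\}^\Lambda$ let $|h|=\#\{\lambda:h_\lambda=1\}$, and $$Pen(h)=2\sum_{j=1}^{|h|}\sigma_{(j)_h}^2\Big(\log(ne/j)+j^{-1}\log_+(n\|\Sigma\|)\Big),$$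 where $\sigma_{(j)_h}^2$ is the $j$-th largest value among $\{h_\lambda\sigma_\lambda^2:\lambda\in\Lambda\}$ and $\log_+(z)=\max(\log z,0)$. The minimization defining $h^\star$ is pointwise in the data: $h^\star:\mathbb R^\Lambda\to\{0,1\}^\Lambda$ is Borel measurable and for every $x\in\mathbb R^\Lambda$ the value $h^\star(x)$ belongs to the (finite) set $\{h(x):h\in\mathcal H\}$ and minimizes the criterion (evaluated at $X=x$) over this set. Equivalently, $h^\star$ minimizes $-\sum_\lambda h_\lambda X_\lambda^2+2Pen(h)$. *)

theory Defs
  imports "HOL-Probability.Probability"
begin

text \<open>
  The finite nonempty index set is the universe of a type \<open>'l\<close> of class \<open>finite\<close>, so that
  \<open>n = CARD('l)\<close>, and coefficient sequences are vectors in \<open>real ^ 'l\<close>. The noise covariance is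
  \<open>diag (\<sigma>\<^sub>l\<^sup>2)\<close>, represented by the vector \<open>\<sigma>\<close> of standard deviations.
\<close>

definition L2_norm :: "'b measure \<Rightarrow> ('b \<Rightarrow> real) \<Rightarrow> real" where
  "L2_norm N g = sqrt (\<integral>t. (g t)\<^sup>2 \<partial>N)"

definition orthonormal_L2 :: "'b measure \<Rightarrow> ('l \<Rightarrow> 'b \<Rightarrow> real) \<Rightarrow> bool" where
  "orthonormal_L2 N \<psi> \<longleftrightarrow>
     (\<forall>l. \<psi> l \<in> borel_measurable N \<and> integrable N (\<lambda>t. (\<psi> l t)\<^sup>2)) \<and>
     (\<forall>l m. (\<integral>t. \<psi> l t * \<psi> m t \<partial>N) = (if l = m then 1 else 0))"

definition synth :: "('l::finite \<Rightarrow> 'b \<Rightarrow> real) \<Rightarrow> real ^ 'l \<Rightarrow> 'b \<Rightarrow> real" where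
  "synth \<psi> c = (\<lambda>t. \<Sum>l\<in>UNIV. c $ l * \<psi> l t)"

definition f_hat :: "('l::finite \<Rightarrow> 'b \<Rightarrow> real) \<Rightarrow> real ^ 'l \<Rightarrow> real ^ 'l \<Rightarrow> 'b \<Rightarrow> real" where
  "f_hat \<psi> h x = synth \<psi> (\<chi> l. h $ l * x $ l)"

definition observation :: "real ^ 'l \<Rightarrow> ('l::finite \<Rightarrow> 'a \<Rightarrow> real) \<Rightarrow> 'a \<Rightarrow> real ^ 'l" where
  "observation f \<xi> \<omega> = (\<chi> l. f $ l + \<xi> l \<omega>)"

text \<open>A normal vector with diagonal covariance: independent centred normal coordinates.\<close>

definition gaussian_noise :: "'a measure \<Rightarrow> real ^ 'l \<Rightarrow> ('l::finite \<Rightarrow> 'a \<Rightarrow> real) \<Rightarrow> bool" where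
  "gaussian_noise M \<sigma> \<xi> \<longleftrightarrow>
     prob_space.indep_vars M (\<lambda>_. borel) \<xi> UNIV \<and>
     (\<forall>l. distributed M lborel (\<xi> l) (normal_density 0 (\<sigma> $ l)))"

definition cov_norm :: "real ^ 'l::finite \<Rightarrow> real" where
  "cov_norm \<sigma> = Max (range (\<lambda>l. (\<sigma> $ l)\<^sup>2))"

definition selection_rules :: "(real ^ 'l::finite \<Rightarrow> real ^ 'l) set" where
  "selection_rules = {h \<in> borel_measurable borel. \<forall>x l. h x $ l \<in> {0, 1}}"

definition subset_size :: "real ^ 'l::finite \<Rightarrow> nat" where
  "subset_size h = card {l. h $ l = 1}"

text \<open>The \<open>j\<close>-th largest of the values \<open>h\<^sub>l \<sigma>\<^sub>l\<^sup>2\<close>, counted with multiplicity; \<open>j\<close> starts at 1.\<close>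

definition ordered_var :: "real ^ 'l::finite \<Rightarrow> real ^ 'l \<Rightarrow> nat \<Rightarrow> real" where
  "ordered_var \<sigma> h j =
     rev (sorted_list_of_multiset (image_mset (\<lambda>l. h $ l * (\<sigma> $ l)\<^sup>2) (mset_set UNIV))) ! (j - 1)"

definition log_plus :: "real \<Rightarrow> real" where
  "log_plus z = max (ln z) 0"

definition Pen :: "real ^ 'l::finite \<Rightarrow> real ^ 'l \<Rightarrow> real" where
  "Pen \<sigma> h = 2 * (\<Sum>j = 1..subset_size h. ordered_var \<sigma> h j *
     (ln (real CARD('l) * exp 1 / real j) + log_plus (real CARD('l) * cov_norm \<sigma>) / real j))"

definition penalized_risk ::
    "'b measure \<Rightarrow> ('l::finite \<Rightarrow> 'b \<Rightarrow> real) \<Rightarrow> real ^ 'l \<Rightarrow> real ^ 'l \<Rightarrow> real ^ 'l \<Rightarrow> real" where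
  "penalized_risk N \<psi> \<sigma> x h = (L2_norm N (\<lambda>t. f_hat \<psi> h x t - synth \<psi> x t))\<^sup>2 + 2 * Pen \<sigma> h"

text \<open>
  The minimizer is a measurable rule, but it need not belong to \<open>H\<close> as a function: only its value
  at each data point is attained by some member of \<open>H\<close>.
\<close>

definition is_penalized_minimizer ::
    "'b measure \<Rightarrow> ('l::finite \<Rightarrow> 'b \<Rightarrow> real) \<Rightarrow> real ^ 'l \<Rightarrow>
     (real ^ 'l \<Rightarrow> real ^ 'l) set \<Rightarrow> (real ^ 'l \<Rightarrow> real ^ 'l) \<Rightarrow> bool" where
  "is_penalized_minimizer N \<psi> \<sigma> H hs \<longleftrightarrow>
     hs \<in> selection_rules \<and>
     (\<forall>x. hs x \<in> (\<lambda>h. h x) ` H \<and>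
          (\<forall>h\<in>H. penalized_risk N \<psi> \<sigma> x (hs x) \<le> penalized_risk N \<psi> \<sigma> x (h x)))"

end

theory Submission
  imports Defs
begin

text \<open>
  Write \<open>X = f + \<xi>\<close>, \<open>h = hs X\<close> and \<open>C(h)\<close> for the expression inside the infimum. By orthonormality,
  the penalized risk of \<open>h\<close> differs from \<open>C(h)\<close> by a term free of \<open>h\<close>, so \<open>hs\<close> attains the infimum at
  every data point. Expanding the squares, the loss satisfies the identity

  \<open>\<Sum>\<^sub>l ((1 - h\<^sub>l) f\<^sub>l\<^sup>2 + h\<^sub>l \<xi>\<^sub>l\<^sup>2) = (1 + \<delta>) C(h) + 2 (1 + \<delta>) (\<Sum>\<^sub>l h\<^sub>l \<xi>\<^sub>l\<^sup>2 - Pen h)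
     + \<Sum>\<^sub>l (2 (1 + \<delta>) h\<^sub>l f\<^sub>l \<xi>\<^sub>l - \<delta> (1 - h\<^sub>l) f\<^sub>l\<^sup>2 - \<delta> h\<^sub>l \<xi>\<^sub>l\<^sup>2)\<close>.

  Since \<open>h\<close> depends on the noise, the last two terms are bounded for all \<open>h\<close> simultaneously before
  expectations are taken.

  The noise term. Put \<open>v\<^sub>l = \<xi>\<^sub>l\<^sup>2 / \<sigma>\<^sub>l\<^sup>2\<close>, and let \<open>\<tau>\<^sub>j\<close> be the factor that multiplies the \<open>j\<close>-th largest
  variance in \<open>Pen\<close>. Order the support of \<open>h\<close> by decreasing \<open>v\<close>. As \<open>\<tau>\<close> is decreasing, the
  rearrangement inequality shows that pairing \<open>\<tau>\<close> with the variances in this order costs at most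
  \<open>Pen h\<close>. Hence the noise term is at most \<open>\<parallel>\<Sigma>\<parallel>\<close> times the sum over \<open>j\<close> of the excess over \<open>\<tau>\<^sub>j\<close> of
  the \<open>j\<close>-th largest \<open>v\<close>. That excess is positive only if \<open>j\<close> independent squares all exceed \<open>\<tau>\<^sub>j\<close>, which
  for a given set of \<open>j\<close> indices has probability at most \<open>q\<^sup>j\<close> with \<open>q = exp (- \<tau>\<^sub>j / 2) / \<surd>\<pi>\<close>. The
  thresholds are made to beat the number \<open>n choose j\<close> of such sets, and the prefactors \<open>(1 / \<surd>\<pi>)\<^sup>j\<close> sum to
  less than \<open>\<surd>2\<close> (lemmas \<open>noise_minus_Pen_le_joint_excess\<close> and \<open>expected_joint_excess_le\<close>). The
  surplus \<open>exp (- log\<^sub>+ (n \<parallel>\<Sigma>\<parallel>))\<close> turns \<open>\<parallel>\<Sigma>\<parallel>\<close> into \<open>min (1 / n) \<parallel>\<Sigma>\<parallel>\<close>.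

  The cross term is treated in each coordinate. If \<open>f\<^sub>l\<^sup>2 \<le> \<sigma>\<^sub>l\<^sup>2\<close>, then \<open>\<delta> \<xi>\<^sub>l\<^sup>2\<close> absorbs \<open>f\<^sub>l \<xi>\<^sub>l\<close> up to a multiple
  of \<open>f\<^sub>l\<^sup>2\<close>. Otherwise \<open>h\<^sub>l f\<^sub>l \<xi>\<^sub>l = f\<^sub>l \<xi>\<^sub>l - (1 - h\<^sub>l) f\<^sub>l \<xi>\<^sub>l\<close>, whose first part has mean zero while \<open>\<delta> f\<^sub>l\<^sup>2\<close>
  absorbs the second up to a multiple of \<open>\<xi>\<^sub>l\<^sup>2\<close>. Either bound is needed only for one sign of
  \<open>f\<^sub>l \<xi>\<^sub>l\<close>, so the symmetry of the noise halves the constant \<open>4 / \<delta>\<close> to \<open>2 / \<delta>\<close>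
  (lemmas \<open>coordinate_bound\<close> and \<open>coordinate_remainder_expectation\<close>).
\<close>

section \<open>Rearrangement and the penalty\<close>

lemma weighted_sum_upd:
  fixes t :: "nat \<Rightarrow> real"
  shows "(\<Sum>i<length (us @ y # ws). (us @ y # ws) ! i * t i)
       = (\<Sum>i<length (us @ x # ws). (us @ x # ws) ! i * t i) + (y - x) * t (length us)"
proof (induction us arbitrary: t)
  case Nil
  then show ?case
    by (simp add: sum.lessThan_Suc_shift algebra_simps del: sum.lessThan_Suc)
next
  case (Cons u us)
  show ?case
    using Cons.IH[of "\<lambda>i. t (Suc i)"]
    by (simp add: sum.lessThan_Suc_shift algebra_simps del: sum.lessThan_Suc)
qed

text \<open>
  Swapping the maximal entry into the first place cannot decrease the weighted sum, because the first
  weight is the largest; the tails are then compared by induction.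
\<close>

lemma rearrangement_list:
  fixes zs ys :: "real list" and t :: "nat \<Rightarrow> real"
  assumes "mset zs = mset ys" and "sorted (rev ys)"
    and "\<And>i j. i \<le> j \<Longrightarrow> j < length ys \<Longrightarrow> t j \<le> t i"
  shows "(\<Sum>i<length zs. zs ! i * t i) \<le> (\<Sum>i<length ys. ys ! i * t i)"
  using assms
proof (induction ys arbitrary: zs t)
  case Nil
  then show ?case by simp
next
  case (Cons y ys)
  have max: "x \<le> y" if "x \<in> set ys" for x
    using Cons.prems(2) that by (simp add: sorted_append)
  have IH: "(\<Sum>i<length zs. zs ! i * t (Suc i)) \<le> (\<Sum>i<length ys. ys ! i * t (Suc i))"
    if "mset zs = mset ys" for zs
    using that Cons.prems by (intro Cons.IH) (auto simp: sorted_append)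
  have "y \<in> set zs"
    using Cons.prems(1) by (metis list.set_intros(1) set_mset_mset)
  show ?case
  proof (cases zs)
    case Nil
    then show ?thesis using Cons.prems(1) by simp
  next
    case (Cons x zs')
    show ?thesis
    proof (cases "x = y")
      case True
      then have "mset zs' = mset ys" using Cons.prems(1) Cons by simp
      from IH[OF this] show ?thesis
        using True Cons by (simp add: sum.lessThan_Suc_shift del: sum.lessThan_Suc)
    next
      case False
      then have "y \<in> set zs'" using \<open>y \<in> set zs\<close> Cons by simp
      then obtain us ws where zs': "zs' = us @ y # ws" by (meson split_list)
      have ms: "mset (us @ x # ws) = mset ys"
        using Cons.prems(1) Cons zs' by (simp add: add_mset_commute)
      have len: "length us < length ys"
        using arg_cong[OF ms, of size] by simp
      have "x \<in> set ys" using ms by (metis in_set_conv_decomp set_mset_mset)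
      then have xy: "x \<le> y" by (rule max)
      have "t (Suc (length us)) \<le> t 0"
        using Cons.prems(3)[of 0 "Suc (length us)"] len by simp
      then have "(y - x) * t (Suc (length us)) \<le> (y - x) * t 0"
        using xy by (intro mult_left_mono) auto
      moreover have "(\<Sum>i<length zs'. zs' ! i * t (Suc i))
          = (\<Sum>i<length (us @ x # ws). (us @ x # ws) ! i * t (Suc i)) + (y - x) * t (Suc (length us))"
        unfolding zs' by (rule weighted_sum_upd)
      ultimately show ?thesis
        using IH[OF ms] Cons
        by (simp add: sum.lessThan_Suc_shift algebra_simps del: sum.lessThan_Suc)
    qed
  qed
qed

text \<open>
  The factor of the \<open>j\<close>-th largest variance in \<open>Pen\<close>, where \<open>D\<close> stands for \<open>log\<^sub>+ (n \<parallel>\<Sigma>\<parallel>)\<close>.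
\<close>

definition threshold :: "nat \<Rightarrow> real \<Rightarrow> nat \<Rightarrow> real" where
  "threshold n D j = 2 * (ln (real n * exp 1 / real j) + D / real j)"

lemma threshold_antimono:
  assumes "0 \<le> D" "1 \<le> i" "i \<le> j" "j \<le> n"
  shows "threshold n D j \<le> threshold n D i"
  unfolding threshold_def using assms
  by (intro mult_left_mono add_mono) (auto intro!: divide_left_mono)

lemma threshold_ge_2:
  assumes "0 \<le> D" "1 \<le> j" "j \<le> n"
  shows "2 \<le> threshold n D j"
proof -
  have "1 = ln (exp (1::real))" by simp
  also have "\<dots> \<le> ln (real n * exp 1 / real j)"
    using assms by (subst ln_le_cancel_iff) (auto simp: field_simps)
  finally have "1 \<le> ln (real n * exp 1 / real j)" .
  moreover have "0 \<le> D / real j" using assms by simp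
  ultimately have "1 + 0 \<le> ln (real n * exp 1 / real j) + D / real j" by (rule add_mono)
  then show ?thesis unfolding threshold_def by simp
qed

text \<open>
  This product of functions of single coordinates dominates the excess of the minimum of \<open>v\<close> over \<open>S\<close>
  above \<open>\<tau> (card S)\<close>: if the minimum exceeds the level then all factors except one equal 1, and the
  remaining one is the excess at some element of \<open>S\<close>. Unlike the minimum itself, a product has an
  expectation that factorizes under independence.
\<close>

definition set_excess :: "(nat \<Rightarrow> real) \<Rightarrow> ('l \<Rightarrow> real) \<Rightarrow> 'l set \<Rightarrow> real" where
  "set_excess \<tau> v S = (\<Prod>l\<in>S. if l = (SOME i. i \<in> S) then max 0 (v l - \<tau> (card S))
                                else of_bool (\<tau> (card S) < v l))"

definition joint_excess :: "(nat \<Rightarrow> real) \<Rightarrow> ('l::finite \<Rightarrow> real) \<Rightarrow> real" where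
  "joint_excess \<tau> v = (\<Sum>S\<in>- {{}}. set_excess \<tau> v S)"

lemma set_excess_nonneg: "0 \<le> set_excess \<tau> v S"
  unfolding set_excess_def by (intro prod_nonneg) auto

lemma joint_excess_nonneg: "0 \<le> joint_excess \<tau> v"
  unfolding joint_excess_def by (intro sum_nonneg set_excess_nonneg)

lemma min_excess_le_set_excess:
  assumes "S \<noteq> {}" "finite S" and "\<And>l. l \<in> S \<Longrightarrow> m \<le> v l"
  shows "max 0 (m - \<tau> (card S)) \<le> set_excess \<tau> v S"
proof (cases "\<tau> (card S) < m")
  case False
  then show ?thesis by (simp add: set_excess_nonneg)
next
  case True
  define i where "i = (SOME i. i \<in> S)"
  have i: "i \<in> S" unfolding i_def using assms(1) by (simp add: some_in_eq)
  have "set_excess \<tau> v S = max 0 (v i - \<tau> (card S)) * (\<Prod>l\<in>S - {i}. of_bool (\<tau> (card S) < v l))"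
    unfolding set_excess_def i_def[symmetric] prod.remove[OF assms(2) i] by simp
  also have "(\<Prod>l\<in>S - {i}. of_bool (\<tau> (card S) < v l)) = (1::real)"
    using True assms(3) by (intro prod.neutral) force
  finally show ?thesis using assms(3)[OF i] by simp
qed

text \<open>
  The \<open>i\<close>-th entry of the sorted list is the minimum of \<open>v\<close> over the first \<open>i\<close> entries. These initial
  segments are distinct nonempty sets, so their excesses are among the summands of \<open>joint_excess\<close>.
\<close>

lemma sorted_excess_le_joint_excess:
  fixes xs :: "'l::finite list" and v w :: "'l \<Rightarrow> real"
  assumes "distinct xs" and "\<And>i j. i \<le> j \<Longrightarrow> j < length xs \<Longrightarrow> v (xs ! j) \<le> v (xs ! i)"
    and w: "\<And>l. 0 \<le> w l" "\<And>l. w l \<le> C"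
  shows "(\<Sum>i<length xs. w (xs ! i) * (v (xs ! i) - \<tau> (Suc i))) \<le> C * joint_excess \<tau> v"
proof -
  define P where "P i = set (take (Suc i) xs)" for i
  have card_P: "card (P i) = Suc i" if "i < length xs" for i
    unfolding P_def using that assms(1) by (simp add: distinct_card)
  have inj: "inj_on P {..<length xs}"
    by (rule inj_onI) (metis card_P lessThan_iff nat.inject)
  have "C \<ge> 0" using w by (meson order_trans)
  have "w (xs ! i) * (v (xs ! i) - \<tau> (Suc i)) \<le> C * set_excess \<tau> v (P i)"
    if i: "i < length xs" for i
  proof -
    have "v (xs ! i) \<le> v l" if "l \<in> P i" for l
      using that i assms(2) by (auto simp: P_def in_set_conv_nth)
    then have "max 0 (v (xs ! i) - \<tau> (card (P i))) \<le> set_excess \<tau> v (P i)"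
      using card_P[OF i] by (intro min_excess_le_set_excess) auto
    then have "max 0 (v (xs ! i) - \<tau> (Suc i)) \<le> set_excess \<tau> v (P i)"
      by (simp add: card_P[OF i])
    moreover have "w (xs ! i) * (v (xs ! i) - \<tau> (Suc i)) \<le> C * max 0 (v (xs ! i) - \<tau> (Suc i))"
      using w \<open>C \<ge> 0\<close>
      by (intro order_trans[OF mult_left_mono[of _ "max 0 (v (xs ! i) - \<tau> (Suc i))"] mult_right_mono]) auto
    ultimately show ?thesis
      using \<open>C \<ge> 0\<close> by (meson mult_left_mono order_trans)
  qed
  then have "(\<Sum>i<length xs. w (xs ! i) * (v (xs ! i) - \<tau> (Suc i)))
      \<le> (\<Sum>i<length xs. C * set_excess \<tau> v (P i))"
    by (intro sum_mono) auto
  also have "\<dots> = C * (\<Sum>S\<in>P ` {..<length xs}. set_excess \<tau> v S)"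
    by (simp add: sum.reindex[OF inj] sum_distrib_left)
  also have "\<dots> \<le> C * joint_excess \<tau> v"
    unfolding joint_excess_def using \<open>C \<ge> 0\<close> card_P
    by (intro mult_left_mono sum_mono2) (force simp: set_excess_nonneg)+
  finally show ?thesis .
qed

lemma cov_norm_upper: "(\<sigma> $ l)\<^sup>2 \<le> cov_norm \<sigma>" for \<sigma> :: "real ^ 'l::finite"
  unfolding cov_norm_def by (intro Max_ge) auto

text \<open>
  In \<open>Pen\<close> the thresholds are paired with the variances in decreasing order of the variances, whereas
  \<open>sorted_excess_le_joint_excess\<close> needs the pairing in decreasing order of \<open>v\<close>. The rearrangement
  inequality says that \<open>Pen\<close> is the larger of the two.
\<close>

lemma noise_minus_Pen_le_joint_excess:
  fixes \<sigma> h :: "real ^ 'l::finite" and v :: "'l \<Rightarrow> real"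
  defines "\<tau> \<equiv> threshold CARD('l) (log_plus (real CARD('l) * cov_norm \<sigma>))"
  assumes h: "\<And>l. h $ l \<in> {0, 1}"
  shows "(\<Sum>l\<in>UNIV. h $ l * ((\<sigma> $ l)\<^sup>2 * v l)) - Pen \<sigma> h \<le> cov_norm \<sigma> * joint_excess \<tau> v"
proof -
  define A where "A = {l. h $ l = 1}"
  obtain as where as: "set as = A" "distinct as" using finite_distinct_list[of A] by auto
  obtain rs where rs: "set rs = - A" "distinct rs" using finite_distinct_list[of "- A"] by auto
  define xs where "xs = sort_key (\<lambda>l. - v l) as"
  have xs: "set xs = A" "distinct xs" using as by (simp_all add: xs_def)
  have desc: "v (xs ! j) \<le> v (xs ! i)" if "i \<le> j" "j < length xs" for i j
  proof -
    have "sorted (map (\<lambda>l. - v l) xs)" by (simp add: xs_def)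
    from sorted_nth_mono[OF this that(1)] that show ?thesis by simp
  qed
  define k where "k = length xs"
  have k: "k = subset_size h"
    unfolding k_def subset_size_def using distinct_card[OF xs(2)] xs(1) by (simp add: A_def)
  have kn: "k \<le> CARD('l)" unfolding k subset_size_def by (rule card_mono) auto
  have D: "0 \<le> log_plus (real CARD('l) * cov_norm \<sigma>)" by (simp add: log_plus_def)
  define s where "s l = h $ l * (\<sigma> $ l)\<^sup>2" for l
  \<comment> \<open>Padding the thresholds with zeros allows comparing full lists of \<open>CARD('l)\<close> variances, so that
    the entries of \<open>ordered_var\<close> beyond the size of \<open>h\<close> need no separate argument.\<close>
  define t where "t i = (if i < k then \<tau> (Suc i) else 0)" for i
  define ys where "ys = rev (sorted_list_of_multiset (image_mset s (mset_set UNIV)))"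
  define zs where "zs = map s (xs @ rs)"
  have lys: "length ys = CARD('l)"
    unfolding ys_def by (metis length_rev mset_sorted_list_of_multiset size_image_mset size_mset size_mset_set)
  have dist: "distinct (xs @ rs)" "set (xs @ rs) = UNIV" using xs rs by auto
  have "mset (xs @ rs) = mset_set UNIV"
    using mset_set_set[OF dist(1)] dist(2) by metis
  then have mzs: "mset zs = mset ys" unfolding zs_def ys_def by (metis mset_map mset_rev mset_sorted_list_of_multiset)
  have t_anti: "t j \<le> t i" if "i \<le> j" "j < length ys" for i j
  proof -
    have "0 \<le> \<tau> (Suc i)" if "i < k"
      using threshold_ge_2[OF D, of "Suc i" "CARD('l)"] that kn unfolding \<tau>_def by simp
    moreover have "\<tau> (Suc j) \<le> \<tau> (Suc i)" if "j < k"
      unfolding \<tau>_def using that kn \<open>i \<le> j\<close> by (intro threshold_antimono[OF D]) auto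
    ultimately show ?thesis using that unfolding t_def by auto
  qed
  have lzs: "length zs = CARD('l)" using mzs lys by (metis size_mset)
  have restrict: "(\<Sum>i<CARD('l). q i * t i) = (\<Sum>i<k. q i * \<tau> (Suc i))" for q :: "nat \<Rightarrow> real"
  proof -
    have "(\<Sum>i<CARD('l). q i * t i) = (\<Sum>i<k. q i * t i)"
      using kn by (intro sum.mono_neutral_right) (auto simp: t_def)
    then show ?thesis by (simp add: t_def)
  qed
  have "(\<Sum>i<k. s (xs ! i) * \<tau> (Suc i)) = (\<Sum>i<k. zs ! i * \<tau> (Suc i))"
    by (intro sum.cong) (auto simp: zs_def nth_append k_def)
  also have "\<dots> \<le> (\<Sum>i<k. ys ! i * \<tau> (Suc i))"
    using rearrangement_list[of zs ys t, OF mzs _ t_anti] unfolding lys lzs restrict by (simp add: ys_def)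
  also have "\<dots> = Pen \<sigma> h"
    unfolding Pen_def k[symmetric] ordered_var_def s_def[symmetric] ys_def[symmetric]
    unfolding One_nat_def sum.atLeast1_atMost_eq
    by (simp add: sum_distrib_left \<tau>_def threshold_def algebra_simps)
  finally have pen: "(\<Sum>i<k. s (xs ! i) * \<tau> (Suc i)) \<le> Pen \<sigma> h" .
  have "(\<Sum>l\<in>UNIV. h $ l * ((\<sigma> $ l)\<^sup>2 * v l)) = (\<Sum>l\<in>A. s l * v l)"
    using h by (intro sum.mono_neutral_cong_right) (force simp: A_def s_def)+
  also have "\<dots> = (\<Sum>i<k. s (xs ! i) * v (xs ! i))"
    using sum.reindex_bij_betw[OF bij_betw_nth[OF xs(2) refl xs(1)[symmetric]], of "\<lambda>l. s l * v l"]
    by (simp add: k_def)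
  finally have "(\<Sum>l\<in>UNIV. h $ l * ((\<sigma> $ l)\<^sup>2 * v l)) - Pen \<sigma> h
      \<le> (\<Sum>i<k. s (xs ! i) * (v (xs ! i) - \<tau> (Suc i)))"
    using pen by (simp add: algebra_simps sum_subtractf)
  also have "\<dots> \<le> cov_norm \<sigma> * joint_excess \<tau> v"
    unfolding k_def
  proof (rule sorted_excess_le_joint_excess[OF xs(2)])
    show "v (xs ! j) \<le> v (xs ! i)" if "i \<le> j" "j < length xs" for i j
      using that by (rule desc)
    fix l
    show "0 \<le> s l" "s l \<le> cov_norm \<sigma>"
      using h[of l] cov_norm_upper[of \<sigma> l] by (auto simp: s_def intro: order_trans[OF zero_le_power2])
  qed
  finally show ?thesis .
qed

section \<open>Tails of the normal distribution\<close>

lemma normal_reflect: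
  assumes "prob_space M" "0 < \<sigma>" and D: "distributed M lborel X (normal_density 0 \<sigma>)"
  shows "distributed M lborel (\<lambda>\<omega>. - X \<omega>) (normal_density 0 \<sigma>)"
  using prob_space.normal_density_affine[OF assms(1) D assms(2), of "-1" 0] by simp

lemma normal_nn_integral_reflect:
  assumes "prob_space M" "0 < \<sigma>" and D: "distributed M lborel X (normal_density 0 \<sigma>)"
    and g: "g \<in> borel_measurable borel"
  shows "(\<integral>\<^sup>+\<omega>. g (- X \<omega>) \<partial>M) = (\<integral>\<^sup>+\<omega>. g (X \<omega>) \<partial>M)"
  using distributed_nn_integral[OF D, of g] distributed_nn_integral[OF normal_reflect[OF assms(1-3)], of g] g
  by simp

text \<open>
  For a symmetric law, \<open>g X\<close> and \<open>g (- X)\<close> have the same expectation. Applied with \<open>g\<close> supported on one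
  half-line, this gains the factor \<open>1 / 2\<close>.
\<close>

lemma normal_integral_le_half:
  fixes g K :: "real \<Rightarrow> real"
  assumes M: "prob_space M" and s: "0 < \<sigma>" and D: "distributed M lborel X (normal_density 0 \<sigma>)"
    and g: "g \<in> borel_measurable borel" "integrable M (\<lambda>\<omega>. g (X \<omega>))"
    and K: "integrable M (\<lambda>\<omega>. K (X \<omega>))" "\<And>x. g x + g (- x) \<le> K x"
  shows "(\<integral>\<omega>. g (X \<omega>) \<partial>M) \<le> (\<integral>\<omega>. K (X \<omega>) \<partial>M) / 2"
proof -
  note R = normal_reflect[OF M s D]
  have eq: "(\<integral>\<omega>. g (- X \<omega>) \<partial>M) = (\<integral>\<omega>. g (X \<omega>) \<partial>M)"
    using distributed_integral[OF D, of g] distributed_integral[OF R, of g] g(1) by simp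
  have int: "integrable M (\<lambda>\<omega>. g (- X \<omega>))"
    using distributed_integrable[OF D, of g] distributed_integrable[OF R, of g] g by simp
  have "(\<integral>\<omega>. g (X \<omega>) + g (- X \<omega>) \<partial>M) \<le> (\<integral>\<omega>. K (X \<omega>) \<partial>M)"
    using g int K by (intro integral_mono) auto
  then show ?thesis using g int eq by simp
qed

lemma std_normal_density_has_derivative [derivative_intros]:
  "(f has_real_derivative D) (at x within A) \<Longrightarrow>
   ((\<lambda>x. std_normal_density (f x)) has_real_derivative - f x * std_normal_density (f x) * D) (at x within A)"
proof -
  define c where "c = 1 / sqrt (2 * pi)"
  show "(f has_real_derivative D) (at x within A) \<Longrightarrow>
    ((\<lambda>x. std_normal_density (f x)) has_real_derivative - f x * std_normal_density (f x) * D) (at x within A)"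
    unfolding std_normal_density_def c_def[symmetric] by (auto intro!: derivative_eq_intros)
qed

text \<open>
  On \<open>{t..}\<close> the integrand may be multiplied by \<open>x / t \<ge> 1\<close>, after which it has an elementary
  antiderivative (Mills' inequality and its analogue for the second moment).
\<close>

lemma std_normal_tail_integrals:
  assumes t: "0 < t"
  shows "(\<integral>\<^sup>+x. ennreal (std_normal_density x * indicator {t..} x) \<partial>lborel) \<le> ennreal (std_normal_density t / t)"
    and "(\<integral>\<^sup>+x. ennreal (std_normal_density x * ((x\<^sup>2 - t\<^sup>2) * indicator {t..} x)) \<partial>lborel)
           \<le> ennreal (2 * std_normal_density t / t)"
proof -
  define F where "F x = - std_normal_density x / t" for x
  have "(\<integral>\<^sup>+x. ennreal (std_normal_density x * (x / t)) * indicator {t..} x \<partial>lborel) = ennreal (0 - F t)"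
  proof (rule nn_integral_FTC_atLeast)
    show "(F has_real_derivative std_normal_density x * (x / t)) (at x)" if "t \<le> x" for x
      unfolding F_def using t
      by (auto intro!: derivative_eq_intros simp: field_simps)
    show "(F \<longlongrightarrow> 0) at_top"
      unfolding F_def std_normal_density_def using t by real_asymp
  qed (use t in auto)
  moreover have "(\<integral>\<^sup>+x. ennreal (std_normal_density x * indicator {t..} x) \<partial>lborel)
      \<le> (\<integral>\<^sup>+x. ennreal (std_normal_density x * (x / t)) * indicator {t..} x \<partial>lborel)"
  proof (intro nn_integral_mono)
    fix x :: real
    show "ennreal (std_normal_density x * indicator {t..} x)
        \<le> ennreal (std_normal_density x * (x / t)) * indicator {t..} x"
    proof (cases "t \<le> x")
      case True
      then have "std_normal_density x * 1 \<le> std_normal_density x * (x / t)"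
        using t by (intro mult_left_mono) auto
      then show ?thesis using True by (auto intro!: ennreal_leI)
    qed auto
  qed
  ultimately show "(\<integral>\<^sup>+x. ennreal (std_normal_density x * indicator {t..} x) \<partial>lborel) \<le> ennreal (std_normal_density t / t)"
    by (simp add: F_def)
next
  \<comment> \<open>Antiderivative of \<open>\<phi> x * (x\<^sup>2 - t\<^sup>2) * (x / t)\<close>, \<open>\<phi>\<close> being the standard normal density.\<close>
  define F where "F x = - (x\<^sup>2 - t\<^sup>2 + 2) * std_normal_density x / t" for x
  have "(\<integral>\<^sup>+x. ennreal (std_normal_density x * ((x\<^sup>2 - t\<^sup>2) * (x / t))) * indicator {t..} x \<partial>lborel) = ennreal (0 - F t)"
  proof (rule nn_integral_FTC_atLeast)
    show "(F has_real_derivative std_normal_density x * ((x\<^sup>2 - t\<^sup>2) * (x / t))) (at x)" if "t \<le> x" for x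
      unfolding F_def using t
      by (auto intro!: derivative_eq_intros simp: field_simps power2_eq_square)
    show "(F \<longlongrightarrow> 0) at_top"
      unfolding F_def std_normal_density_def using t by real_asymp
    show "0 \<le> std_normal_density x * ((x\<^sup>2 - t\<^sup>2) * (x / t))" if "t \<le> x" for x
      using that t by (auto intro!: mult_nonneg_nonneg)
  qed auto
  moreover have "(\<integral>\<^sup>+x. ennreal (std_normal_density x * ((x\<^sup>2 - t\<^sup>2) * indicator {t..} x)) \<partial>lborel)
      \<le> (\<integral>\<^sup>+x. ennreal (std_normal_density x * ((x\<^sup>2 - t\<^sup>2) * (x / t))) * indicator {t..} x \<partial>lborel)"
  proof (intro nn_integral_mono)
    fix x :: real
    show "ennreal (std_normal_density x * ((x\<^sup>2 - t\<^sup>2) * indicator {t..} x))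
        \<le> ennreal (std_normal_density x * ((x\<^sup>2 - t\<^sup>2) * (x / t))) * indicator {t..} x"
    proof (cases "t \<le> x")
      case True
      then have "std_normal_density x * ((x\<^sup>2 - t\<^sup>2) * 1) \<le> std_normal_density x * ((x\<^sup>2 - t\<^sup>2) * (x / t))"
        using t by (intro mult_left_mono) auto
      then show ?thesis using True by (auto intro!: ennreal_leI)
    qed auto
  qed
  ultimately show "(\<integral>\<^sup>+x. ennreal (std_normal_density x * ((x\<^sup>2 - t\<^sup>2) * indicator {t..} x)) \<partial>lborel)
           \<le> ennreal (2 * std_normal_density t / t)"
    by (simp add: F_def)
qed

lemma std_normal_density_div_le:
  assumes "2 \<le> \<tau>"
  shows "2 * (std_normal_density (sqrt \<tau>) / sqrt \<tau>) \<le> exp (- \<tau> / 2) / sqrt pi"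
proof -
  have "2 * (std_normal_density (sqrt \<tau>) / sqrt \<tau>) = exp (- \<tau> / 2) / sqrt pi * (2 / (sqrt 2 * sqrt \<tau>))"
    using assms by (simp add: std_normal_density_def real_sqrt_mult field_simps)
  also have "2 / (sqrt 2 * sqrt \<tau>) \<le> 1"
    using real_sqrt_le_mono[of 4 "2 * \<tau>"] assms by (simp add: real_sqrt_mult[symmetric])
  then have "exp (- \<tau> / 2) / sqrt pi * (2 / (sqrt 2 * sqrt \<tau>)) \<le> exp (- \<tau> / 2) / sqrt pi * 1"
    by (intro mult_left_mono) auto
  finally show ?thesis by simp
qed

text \<open>
  The prefactor \<open>1 / \<surd>\<pi> < 1\<close> is what remains of Mills' ratio at \<open>\<tau> \<ge> 2\<close>. Having it strictly below 1 makes
  the sum over the set sizes converge geometrically.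
\<close>

lemma std_normal_square_tail:
  assumes M: "prob_space M" and D: "distributed M lborel Z std_normal_density" and \<tau>: "2 \<le> \<tau>"
  defines "q \<equiv> exp (- \<tau> / 2) / sqrt pi"
  shows "(\<integral>\<^sup>+\<omega>. ennreal (of_bool (\<tau> < (Z \<omega>)\<^sup>2)) \<partial>M) \<le> ennreal q"
    and "(\<integral>\<^sup>+\<omega>. ennreal (max 0 ((Z \<omega>)\<^sup>2 - \<tau>)) \<partial>M) \<le> ennreal (2 * q)"
proof -
  have [measurable]: "Z \<in> borel_measurable M" using distributed_measurable[OF D] by simp
  define t where "t = sqrt \<tau>"
  have t: "0 < t" "t\<^sup>2 = \<tau>" using \<tau> by (auto simp: t_def)
  have q: "2 * (std_normal_density t / t) \<le> q"
    unfolding t_def q_def by (rule std_normal_density_div_le[OF \<tau>])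
  have two_sided: "(\<integral>\<^sup>+\<omega>. ennreal (g (Z \<omega>) + g (- Z \<omega>)) \<partial>M) \<le> ennreal (c * q)"
    if g: "g \<in> borel_measurable borel" "\<And>x. 0 \<le> g x"
      and le: "(\<integral>\<^sup>+x. ennreal (std_normal_density x * g x) \<partial>lborel) \<le> ennreal (c * (std_normal_density t / t))" and c: "0 \<le> c" for g :: "real \<Rightarrow> real" and c
  proof -
    note [measurable] = g(1)
    have half: "(\<integral>\<^sup>+\<omega>. ennreal (g (Z \<omega>)) \<partial>M) \<le> ennreal (c * (std_normal_density t / t))"
      using distributed_nn_integral[OF D, of "\<lambda>x. ennreal (g x)"] le g by (simp add: ennreal_mult)
    have "(\<integral>\<^sup>+\<omega>. ennreal (g (Z \<omega>) + g (- Z \<omega>)) \<partial>M) = (\<integral>\<^sup>+\<omega>. ennreal (g (Z \<omega>)) \<partial>M) + (\<integral>\<^sup>+\<omega>. ennreal (g (- Z \<omega>)) \<partial>M)"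
      using g by (simp add: nn_integral_add)
    also have "\<dots> = (\<integral>\<^sup>+\<omega>. ennreal (g (Z \<omega>)) \<partial>M) + (\<integral>\<^sup>+\<omega>. ennreal (g (Z \<omega>)) \<partial>M)"
      using normal_nn_integral_reflect[OF M _ D, of "\<lambda>x. ennreal (g x)"] by simp
    also have "\<dots> \<le> ennreal (c * (std_normal_density t / t)) + ennreal (c * (std_normal_density t / t))"
      by (intro add_mono half)
    also have "\<dots> = ennreal (c * (2 * (std_normal_density t / t)))"
      using t c by (simp flip: ennreal_plus)
    also have "\<dots> \<le> ennreal (c * q)" using q c by (intro ennreal_leI mult_left_mono)
    finally show ?thesis .
  qed
  have abs_t: "t < \<bar>x\<bar>" if "\<tau> < x\<^sup>2" for x
    using that t by (metis abs_ge_zero power2_abs power_less_imp_less_base)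
  have "(\<integral>\<^sup>+\<omega>. ennreal (of_bool (\<tau> < (Z \<omega>)\<^sup>2)) \<partial>M)
      \<le> (\<integral>\<^sup>+\<omega>. ennreal (indicator {t..} (Z \<omega>) + indicator {t..} (- Z \<omega>)) \<partial>M)"
    by (intro nn_integral_mono ennreal_leI) (use abs_t in \<open>force simp: indicator_def\<close>)
  also have "\<dots> \<le> ennreal (1 * q)"
    using std_normal_tail_integrals(1)[OF t(1)] by (intro two_sided) auto
  finally show "(\<integral>\<^sup>+\<omega>. ennreal (of_bool (\<tau> < (Z \<omega>)\<^sup>2)) \<partial>M) \<le> ennreal q" by simp
  have sq: "t\<^sup>2 \<le> x\<^sup>2" if "t \<le> x" for x using that t by (intro power_mono) auto
  have "(\<integral>\<^sup>+\<omega>. ennreal (max 0 ((Z \<omega>)\<^sup>2 - \<tau>)) \<partial>M)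
      \<le> (\<integral>\<^sup>+\<omega>. ennreal (((Z \<omega>)\<^sup>2 - t\<^sup>2) * indicator {t..} (Z \<omega>) + ((- Z \<omega>)\<^sup>2 - t\<^sup>2) * indicator {t..} (- Z \<omega>)) \<partial>M)"
  proof (intro nn_integral_mono ennreal_leI)
    fix \<omega>
    show "max 0 ((Z \<omega>)\<^sup>2 - \<tau>)
        \<le> ((Z \<omega>)\<^sup>2 - t\<^sup>2) * indicator {t..} (Z \<omega>) + ((- Z \<omega>)\<^sup>2 - t\<^sup>2) * indicator {t..} (- Z \<omega>)"
    proof (cases "\<tau> < (Z \<omega>)\<^sup>2")
      case True
      then have "t \<le> Z \<omega> \<or> t \<le> - Z \<omega>" using abs_t[OF True] by linarith
      then show ?thesis using t True by (auto simp: indicator_def)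
    next
      case False
      then show ?thesis using sq[of "Z \<omega>"] sq[of "- Z \<omega>"] by (auto simp: indicator_def)
    qed
  qed
  also have "\<dots> \<le> ennreal (2 * q)"
    using std_normal_tail_integrals(2)[OF t(1)] sq
    by (intro two_sided) (auto simp: indicator_def)
  finally show "(\<integral>\<^sup>+\<omega>. ennreal (max 0 ((Z \<omega>)\<^sup>2 - \<tau>)) \<partial>M) \<le> ennreal (2 * q)" .
qed

section \<open>Expected excess over the thresholds\<close>

text \<open>
  The terms of index \<open>j - 1\<close> and \<open>j\<close> in the series of \<open>exp j\<close> are both equal to \<open>j ^ j / fact j\<close>.
\<close>

lemma twice_power_le_fact_exp:
  assumes "1 \<le> j"
  shows "2 * real j ^ j \<le> fact j * exp (real j)"
proof -
  obtain i where j: "j = Suc i" using assms by (cases j) auto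
  have "(\<Sum>k\<in>{i, j}. real j ^ k / fact k) \<le> exp (real j)"
    unfolding exp_def by (intro sum_le_suminf[THEN order_trans]) (auto simp: summable_exp_generic divide_inverse mult.commute intro!: summable_exp)
  moreover have "real j ^ i / fact i = real j ^ j / fact j"
    using j by (simp del: of_nat_Suc)
  ultimately have "2 * (real j ^ j / fact j) \<le> exp (real j)" using j by simp
  then show ?thesis by (simp add: field_simps)
qed

lemma sum_nonempty_subsets:
  fixes F :: "nat \<Rightarrow> real"
  shows "(\<Sum>S\<in>- {{} :: 'l::finite set}. F (card S)) = (\<Sum>j=1..CARD('l). real (CARD('l) choose j) * F j)"
proof -
  have "(\<Sum>S\<in>- {{} :: 'l set}. F (card S)) = (\<Sum>j=1..CARD('l). \<Sum>S | S \<in> - {{} :: 'l set} \<and> card S = j. F (card S))"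
    by (rule sum.group[symmetric])
       (auto simp: Suc_le_eq card_gt_0_iff intro: card_mono[OF finite_class.finite_UNIV subset_UNIV])
  also have "\<dots> = (\<Sum>j=1..CARD('l). real (CARD('l) choose j) * F j)"
  proof (rule sum.cong[OF refl])
    fix j assume "j \<in> {1..CARD('l)}"
    then have "{S. S \<in> - {{} :: 'l set} \<and> card S = j} = {S. S \<subseteq> UNIV \<and> card S = j}" by auto
    then show "(\<Sum>S | S \<in> - {{} :: 'l set} \<and> card S = j. F (card S)) = real (CARD('l) choose j) * F j"
      using n_subsets[of "UNIV :: 'l set" j] by simp
  qed
  finally show ?thesis .
qed

text \<open>
  The term \<open>ln (n e / j)\<close> of the threshold yields \<open>(j / (n e)) ^ j\<close>, which compensates
  \<open>n choose j \<le> n ^ j / fact j\<close>; the term \<open>D / j\<close> contributes one factor \<open>exp (- D)\<close> for every \<open>j\<close>.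
\<close>

lemma tail_power_times_choose_le:
  fixes n j :: nat and D :: real
  assumes "1 \<le> j" "j \<le> n"
  defines "q \<equiv> exp (- threshold n D j / 2) / sqrt pi"
  shows "real (n choose j) * (2 * q ^ j) \<le> (1 / sqrt pi) ^ j * exp (- D)"
proof -
  have n: "0 < real n" "0 < real j" using assms by auto
  have "exp (- threshold n D j / 2) = exp (- ln (real n * exp 1 / real j)) * exp (- (D / real j))"
    by (simp add: threshold_def mult_exp_exp)
  also have "exp (- ln (real n * exp 1 / real j)) = real j / (real n * exp 1)"
    using n by (simp add: exp_minus)
  finally have "q ^ j = (1 / sqrt pi) ^ j * (real j ^ j / (real n ^ j * exp (real j))) * exp (- D)"
    using n by (simp add: q_def power_mult_distrib power_divide exp_of_nat_mult[symmetric])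
  then have "real (n choose j) * (2 * q ^ j)
      = (1 / sqrt pi) ^ j * exp (- D) * (real (n choose j) * (2 * real j ^ j) / (real n ^ j * exp (real j)))"
    by simp
  also have "real (n choose j) * (2 * real j ^ j) \<le> real (n choose j) * (fact j * exp (real j))"
    using twice_power_le_fact_exp[OF assms(1)] by (intro mult_left_mono) auto
  also have "\<dots> = real ((n choose j) * fact j) * exp (real j)" by simp
  also have "\<dots> \<le> real (n ^ j) * exp (real j)"
    using binomial_fact_pow[of n j] by (intro mult_right_mono of_nat_mono) auto
  finally have "real (n choose j) * (2 * q ^ j)
      \<le> (1 / sqrt pi) ^ j * exp (- D) * (real n ^ j * exp (real j) / (real n ^ j * exp (real j)))"
    using n by (simp add: divide_right_mono mult_left_mono)
  then show ?thesis using n by simp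
qed

lemma geometric_sum_inverse_sqrt_pi:
  "(\<Sum>j=1..n. (1 / sqrt pi) ^ j) \<le> sqrt 2"
proof -
  define c where "c = 1 / sqrt pi"
  \<comment> \<open>The ratio \<open>c / (1 - c)\<close> is at most \<open>\<surd>2\<close> up to \<open>c = 0.585...\<close>, and \<open>1 / \<surd>\<pi> = 0.564...\<close>.\<close>
  have "1 / (58/100) \<le> sqrt pi"
    using pi_gt3 by (intro real_le_rsqrt) (simp add: power2_eq_square)
  then have c: "0 < c" "c \<le> 58/100" by (auto simp: c_def field_simps)
  have "(1 - c) * (\<Sum>j=1..n. c ^ j) = c - c ^ Suc n"
    by (induction n) (simp_all add: distrib_left left_diff_distrib)
  also have "\<dots> \<le> c" using c by simp
  finally have "(\<Sum>j=1..n. c ^ j) \<le> c / (1 - c)" using c by (simp add: field_simps)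
  also have "\<dots> \<le> 14/10" using c by (simp add: field_simps)
  also have "\<dots> \<le> sqrt 2" by (intro real_le_rsqrt) (simp add: power2_eq_square)
  finally show ?thesis by (simp add: c_def)
qed

text \<open>
  By independence the expected excess of a set of size \<open>j\<close> is at most \<open>2 q\<^sup>j\<close>, the factor 2 coming from the
  one coordinate whose excess is measured. There are \<open>n choose j\<close> sets of this size.
\<close>

lemma expected_joint_excess_le:
  fixes Z :: "'l::finite \<Rightarrow> 'a \<Rightarrow> real"
  assumes M: "prob_space M" and indep: "prob_space.indep_vars M (\<lambda>_. borel) Z UNIV"
    and D: "\<And>l. distributed M lborel (Z l) std_normal_density" and "0 \<le> D"
  shows "(\<integral>\<^sup>+\<omega>. ennreal (joint_excess (threshold CARD('l) D) (\<lambda>l. (Z l \<omega>)\<^sup>2)) \<partial>M) \<le> ennreal (sqrt 2 * exp (- D))"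
proof -
  interpret prob_space M by (rule M)
  let ?\<tau> = "threshold CARD('l) D"
  define q where "q j = exp (- ?\<tau> j / 2) / sqrt pi" for j
  have [measurable]: "Z l \<in> borel_measurable M" for l using distributed_measurable[OF D] by simp
  have set_excess_le: "(\<integral>\<^sup>+\<omega>. ennreal (set_excess ?\<tau> (\<lambda>l. (Z l \<omega>)\<^sup>2) S) \<partial>M) \<le> ennreal (2 * q (card S) ^ card S)"
    if "S \<noteq> {}" for S :: "'l set"
  proof -
    define i where "i = (SOME i. i \<in> S)"
    have i: "i \<in> S" unfolding i_def using that by (simp add: some_in_eq)
    have \<tau>: "2 \<le> ?\<tau> (card S)"
      using that assms by (intro threshold_ge_2) (auto simp: Suc_le_eq card_gt_0_iff intro: card_mono)
    define g :: "'l \<Rightarrow> real \<Rightarrow> real" where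
      "g l x = (if l = i then max 0 (x\<^sup>2 - ?\<tau> (card S)) else of_bool (?\<tau> (card S) < x\<^sup>2))" for l x
    have [measurable]: "g l \<in> borel_measurable borel" for l unfolding g_def by measurable
    have "(\<integral>\<^sup>+\<omega>. ennreal (set_excess ?\<tau> (\<lambda>l. (Z l \<omega>)\<^sup>2) S) \<partial>M) = (\<integral>\<^sup>+\<omega>. (\<Prod>l\<in>S. ennreal (g l (Z l \<omega>))) \<partial>M)"
      by (subst prod_ennreal) (auto simp: g_def set_excess_def i_def cong: prod.cong)
    also have "\<dots> = (\<Prod>l\<in>S. \<integral>\<^sup>+\<omega>. ennreal (g l (Z l \<omega>)) \<partial>M)"
      by (intro indep_vars_nn_integral indep_vars_compose2[OF indep_vars_subset[OF indep]]) auto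
    also have "\<dots> \<le> (\<Prod>l\<in>S. ennreal (if l = i then 2 * q (card S) else q (card S)))"
      using std_normal_square_tail[OF M D \<tau>]
      by (intro prod_mono_ennreal) (simp add: g_def q_def)
    also have "\<dots> = ennreal (\<Prod>l\<in>S. if l = i then 2 * q (card S) else q (card S))"
      by (rule prod_ennreal) (simp add: q_def)
    also have "(\<Prod>l\<in>S. if l = i then 2 * q (card S) else q (card S)) = 2 * q (card S) ^ card S"
      by (subst prod.remove[OF _ i]) (auto simp: i card_gt_0_iff that power_eq_if[of _ "card S"])
    finally show ?thesis .
  qed
  have "(\<integral>\<^sup>+\<omega>. ennreal (joint_excess ?\<tau> (\<lambda>l. (Z l \<omega>)\<^sup>2)) \<partial>M)
      = (\<Sum>S\<in>- {{}}. \<integral>\<^sup>+\<omega>. ennreal (set_excess ?\<tau> (\<lambda>l. (Z l \<omega>)\<^sup>2) S) \<partial>M)"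
    unfolding joint_excess_def
    by (subst sum_ennreal[symmetric], simp add: set_excess_nonneg, subst nn_integral_sum)
       (auto simp: set_excess_def)
  also have "\<dots> \<le> (\<Sum>S\<in>- {{} :: 'l set}. ennreal (2 * q (card S) ^ card S))"
    by (intro sum_mono set_excess_le) auto
  also have "\<dots> = ennreal (\<Sum>S\<in>- {{} :: 'l set}. 2 * q (card S) ^ card S)"
    by (rule sum_ennreal) (simp add: q_def)
  also have "(\<Sum>S\<in>- {{} :: 'l set}. 2 * q (card S) ^ card S)
      = (\<Sum>j=1..CARD('l). real (CARD('l) choose j) * (2 * q j ^ j))"
    by (rule sum_nonempty_subsets)
  also have "\<dots> \<le> (\<Sum>j=1..CARD('l). (1 / sqrt pi) ^ j * exp (- D))"
    unfolding q_def by (intro sum_mono tail_power_times_choose_le) auto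
  also have "\<dots> = (\<Sum>j=1..CARD('l). (1 / sqrt pi) ^ j) * exp (- D)"
    by (rule sum_distrib_right[symmetric])
  also have "\<dots> \<le> sqrt 2 * exp (- D)"
    by (intro mult_right_mono geometric_sum_inverse_sqrt_pi) auto
  finally show ?thesis by (simp add: ennreal_leI)
qed

lemma cov_norm_times_exp_log_plus_le:
  fixes \<sigma> :: "real ^ 'l::finite"
  assumes "\<And>l. \<sigma> $ l > 0"
  shows "cov_norm \<sigma> * exp (- log_plus (real CARD('l) * cov_norm \<sigma>)) \<le> min (1 / real CARD('l)) (cov_norm \<sigma>)"
proof -
  have "0 < (\<sigma> $ undefined)\<^sup>2" using assms[of undefined] by simp
  also have "\<dots> \<le> cov_norm \<sigma>" by (rule cov_norm_upper)
  finally have c: "0 < cov_norm \<sigma>" .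
  have "exp (- log_plus (real CARD('l) * cov_norm \<sigma>)) \<le> exp (- ln (real CARD('l) * cov_norm \<sigma>))"
    by (simp add: log_plus_def)
  also have "\<dots> = 1 / (real CARD('l) * cov_norm \<sigma>)"
    using c by (simp add: exp_minus inverse_eq_divide)
  finally have "cov_norm \<sigma> * exp (- log_plus (real CARD('l) * cov_norm \<sigma>)) \<le> 1 / real CARD('l)"
    using c by (simp add: field_simps)
  moreover have "cov_norm \<sigma> * exp (- log_plus (real CARD('l) * cov_norm \<sigma>)) \<le> cov_norm \<sigma> * 1"
    using c by (intro mult_left_mono) (auto simp: log_plus_def)
  ultimately show ?thesis by simp
qed

section \<open>The cross term in one coordinate\<close>

text \<open>
  A bound on the cross term that depends on the noise but not on the selection: the first branch serves
  for coordinates that could as well be dropped, the second for those that could as well be kept. The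
  linear term of the second branch has mean zero.
\<close>

definition coordinate_remainder :: "real \<Rightarrow> real \<Rightarrow> real \<Rightarrow> real \<Rightarrow> real" where
  "coordinate_remainder \<delta> \<sigma> f x =
     (if f\<^sup>2 \<le> \<sigma>\<^sup>2 then 4 / \<delta> * f\<^sup>2 * of_bool (0 < f * x)
      else 4 / \<delta> * x\<^sup>2 * of_bool (f * x < 0) + 2 * (1 + \<delta>) * f * x)"

text \<open>
  Complete the square \<open>(\<delta> b - (1 + \<delta>) a)\<^sup>2\<close> and use \<open>1 + \<delta> \<le> 2\<close>.
\<close>

lemma cross_term_bound:
  fixes a b \<delta> :: real
  assumes "0 < \<delta>" "\<delta> < 1"
  shows "2 * (1 + \<delta>) * a * b - \<delta> * b\<^sup>2 \<le> 4 / \<delta> * a\<^sup>2"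
proof -
  have "0 \<le> (\<delta> * b - (1 + \<delta>) * a)\<^sup>2" by simp
  then have "\<delta> * (2 * (1 + \<delta>) * a * b - \<delta> * b\<^sup>2) \<le> (1 + \<delta>)\<^sup>2 * a\<^sup>2"
    by (simp add: power2_eq_square algebra_simps)
  also have "\<dots> \<le> 2\<^sup>2 * a\<^sup>2"
    using assms by (intro mult_right_mono power_mono) auto
  finally show ?thesis using assms by (simp add: field_simps)
qed

text \<open>
  For \<open>f\<^sup>2 \<le> \<sigma>\<^sup>2\<close> only a kept coordinate with \<open>f x > 0\<close> can make the left-hand side positive. For \<open>f\<^sup>2 > \<sigma>\<^sup>2\<close>,
  once \<open>2 (1 + \<delta>) f x\<close> is subtracted on both sides, only a dropped coordinate with \<open>f x < 0\<close> can.
\<close>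

lemma coordinate_bound:
  assumes \<delta>: "0 < \<delta>" "\<delta> < 1" and h: "h \<in> {0, 1}"
  shows "2 * (1 + \<delta>) * h * f * x - \<delta> * (1 - h) * f\<^sup>2 - \<delta> * h * x\<^sup>2 \<le> coordinate_remainder \<delta> \<sigma> f x"
proof -
  define b where "b = 2 * (1 + \<delta>) * f * x"
  have b: "b = 2 * (1 + \<delta>) * (f * x)" by (simp add: b_def)
  have b_pos: "0 \<le> b" if "0 \<le> f * x"
    unfolding b by (rule mult_nonneg_nonneg) (use that \<delta> in simp_all)
  have b_neg: "b \<le> 0" if "f * x \<le> 0"
    unfolding b by (rule mult_nonneg_nonpos) (use that \<delta> in simp_all)
  define F G P Q where "F = 4 / \<delta> * f\<^sup>2" and "G = 4 / \<delta> * x\<^sup>2" and "P = \<delta> * f\<^sup>2" and "Q = \<delta> * x\<^sup>2"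
  have nn: "0 \<le> P" "0 \<le> Q" "0 \<le> F" "0 \<le> G"
    using \<delta> by (simp_all add: F_def G_def P_def Q_def)
  have kept: "b - Q \<le> F"
    using cross_term_bound[OF \<delta>, of f x] by (simp add: b_def F_def Q_def)
  \<comment> \<open>The roles of signal and noise are exchanged.\<close>
  have dropped: "- b - P \<le> G"
    using cross_term_bound[OF \<delta>, of "- x" f] by (simp add: b_def G_def P_def algebra_simps)
  show ?thesis
  proof (cases "f\<^sup>2 \<le> \<sigma>\<^sup>2")
    case True
    have "- P \<le> F * of_bool (0 < f * x)"
      using nn by (cases "0 < f * x") auto
    moreover have "b - Q \<le> F * of_bool (0 < f * x)"
      using nn kept b_neg by (cases "0 < f * x") auto
    ultimately show ?thesis
      using h True by (auto simp: coordinate_remainder_def b_def F_def P_def Q_def)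
  next
    case False
    have "- P \<le> G * of_bool (f * x < 0) + b"
      using nn dropped b_pos by (cases "f * x < 0") auto
    moreover have "b - Q \<le> G * of_bool (f * x < 0) + b"
      using nn by (cases "f * x < 0") auto
    ultimately show ?thesis
      using h False by (auto simp: coordinate_remainder_def b_def G_def P_def Q_def)
  qed
qed

lemma normal_moments:
  assumes M: "prob_space M" and s: "0 < \<sigma>" and D: "distributed M lborel X (normal_density 0 \<sigma>)"
  shows "integrable M X" "integrable M (\<lambda>\<omega>. (X \<omega>)\<^sup>2)"
    "(\<integral>\<omega>. X \<omega> \<partial>M) = 0" "(\<integral>\<omega>. (X \<omega>)\<^sup>2 \<partial>M) = \<sigma>\<^sup>2"
proof -
  show "integrable M X"
    using integrable_normal_moment[OF s, of 0 1] distributed_integrable[OF D, of "\<lambda>x. x"] by simp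
  show "integrable M (\<lambda>\<omega>. (X \<omega>)\<^sup>2)"
    using integrable_normal_moment[OF s, of 0 2] distributed_integrable[OF D, of "\<lambda>x. x\<^sup>2"] by simp
  show m: "(\<integral>\<omega>. X \<omega> \<partial>M) = 0"
    by (rule prob_space.normal_distributed_expectation[OF M s D])
  show "(\<integral>\<omega>. (X \<omega>)\<^sup>2 \<partial>M) = \<sigma>\<^sup>2"
    using prob_space.normal_distributed_variance[OF M s D] m by simp
qed

lemma coordinate_remainder_expectation:
  assumes M: "prob_space M" and s: "0 < \<sigma>" and D: "distributed M lborel X (normal_density 0 \<sigma>)"
    and d: "0 < \<delta>"
  shows "integrable M (\<lambda>\<omega>. coordinate_remainder \<delta> \<sigma> f (X \<omega>))"
    and "(\<integral>\<omega>. coordinate_remainder \<delta> \<sigma> f (X \<omega>) \<partial>M) \<le> 2 / \<delta> * min (f\<^sup>2) (\<sigma>\<^sup>2)"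
proof -
  interpret prob_space M by (rule M)
  note mom = normal_moments[OF M s D]
  have [measurable]: "X \<in> borel_measurable M" using distributed_measurable[OF D] by simp
  have sides: "of_bool (0 < f * x) + of_bool (0 < f * - x) \<le> (1::real)"
    "of_bool (f * x < 0) + of_bool (f * - x < 0) \<le> (1::real)" for x
    by auto
  have int1: "integrable M (\<lambda>\<omega>. of_bool (0 < f * X \<omega>) :: real)"
    by (rule integrable_const_bound[of _ 1]) auto
  have int2: "integrable M (\<lambda>\<omega>. (X \<omega>)\<^sup>2 * of_bool (f * X \<omega> < 0))"
    by (rule Bochner_Integration.integrable_bound[OF mom(2)]) auto
  have "(\<integral>\<omega>. of_bool (0 < f * X \<omega>) \<partial>M) \<le> (\<integral>\<omega>. (1::real) \<partial>M) / 2"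
    using sides int1 by (intro normal_integral_le_half[OF M s D, where g = "\<lambda>x. of_bool (0 < f * x)" and K = "\<lambda>_. 1"]) auto
  then have half1: "(\<integral>\<omega>. of_bool (0 < f * X \<omega>) \<partial>M) \<le> (1/2::real)" by (simp add: prob_space)
  have "x\<^sup>2 * of_bool (f * x < 0) + (- x)\<^sup>2 * of_bool (f * - x < 0) \<le> x\<^sup>2" for x
    by auto
  then have "(\<integral>\<omega>. (X \<omega>)\<^sup>2 * of_bool (f * X \<omega> < 0) \<partial>M) \<le> (\<integral>\<omega>. (X \<omega>)\<^sup>2 \<partial>M) / 2"
    using int2 mom(2)
    by (intro normal_integral_le_half[OF M s D, where g = "\<lambda>x. x\<^sup>2 * of_bool (f * x < 0)" and K = "\<lambda>x. x\<^sup>2"]) auto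
  then have half2: "(\<integral>\<omega>. (X \<omega>)\<^sup>2 * of_bool (f * X \<omega> < 0) \<partial>M) \<le> \<sigma>\<^sup>2 / 2" by (simp add: mom)
  show "integrable M (\<lambda>\<omega>. coordinate_remainder \<delta> \<sigma> f (X \<omega>))"
    using int1 int2 mom by (cases "f\<^sup>2 \<le> \<sigma>\<^sup>2") (simp_all add: coordinate_remainder_def mult.assoc)
  show "(\<integral>\<omega>. coordinate_remainder \<delta> \<sigma> f (X \<omega>) \<partial>M) \<le> 2 / \<delta> * min (f\<^sup>2) (\<sigma>\<^sup>2)"
  proof (cases "f\<^sup>2 \<le> \<sigma>\<^sup>2")
    case True
    have "4 / \<delta> * f\<^sup>2 * (\<integral>\<omega>. of_bool (0 < f * X \<omega>) \<partial>M) \<le> 4 / \<delta> * f\<^sup>2 * (1/2)"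
      using d half1 by (intro mult_left_mono) auto
    then show ?thesis using True by (simp add: coordinate_remainder_def)
  next
    case False
    have "4 / \<delta> * (\<integral>\<omega>. (X \<omega>)\<^sup>2 * of_bool (f * X \<omega> < 0) \<partial>M) \<le> 4 / \<delta> * (\<sigma>\<^sup>2 / 2)"
      using d half2 by (intro mult_left_mono) auto
    then show ?thesis using False int2 mom by (simp add: coordinate_remainder_def mult.assoc)
  qed
qed

section \<open>Loss and penalized criterion\<close>

lemma L2_norm_synth_squared:
  assumes "orthonormal_L2 N \<psi>"
  shows "(L2_norm N (synth \<psi> c))\<^sup>2 = (\<Sum>l\<in>UNIV. (c $ l)\<^sup>2)"
proof -
  have [measurable]: "\<psi> l \<in> borel_measurable N" and sq: "integrable N (\<lambda>t. (\<psi> l t)\<^sup>2)"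
    and orth: "(\<integral>t. \<psi> l t * \<psi> m t \<partial>N) = (if l = m then 1 else 0)" for l m
    using assms by (auto simp: orthonormal_L2_def)
  have int: "integrable N (\<lambda>t. \<psi> l t * \<psi> m t)" for l m
  proof (rule Bochner_Integration.integrable_bound)
    show "integrable N (\<lambda>t. (\<psi> l t)\<^sup>2 + (\<psi> m t)\<^sup>2)" using sq by simp
    have "\<bar>a * b\<bar> \<le> a\<^sup>2 + b\<^sup>2" for a b :: real
    proof -
      have "2 * \<bar>a * b\<bar> \<le> a\<^sup>2 + b\<^sup>2"
        using sum_squares_bound[of "\<bar>a\<bar>" "\<bar>b\<bar>"] by (simp add: abs_mult)
      then show ?thesis by (smt (verit) abs_ge_zero)
    qed
    then show "AE t in N. norm (\<psi> l t * \<psi> m t) \<le> norm ((\<psi> l t)\<^sup>2 + (\<psi> m t)\<^sup>2)" by simp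
  qed measurable
  have "(\<integral>t. (synth \<psi> c t)\<^sup>2 \<partial>N) = (\<integral>t. (\<Sum>l\<in>UNIV. \<Sum>m\<in>UNIV. c $ l * c $ m * (\<psi> l t * \<psi> m t)) \<partial>N)"
    by (simp add: synth_def power2_eq_square sum_product mult_ac)
  also have "\<dots> = (\<Sum>l\<in>UNIV. \<Sum>m\<in>UNIV. c $ l * c $ m * (if l = m then 1 else 0))"
    using int by (simp add: orth)
  also have "\<dots> = (\<Sum>l\<in>UNIV. (c $ l)\<^sup>2)"
    by (simp add: power2_eq_square if_distrib cong: if_cong)
  finally have "(\<integral>t. (synth \<psi> c t)\<^sup>2 \<partial>N) = (\<Sum>l\<in>UNIV. (c $ l)\<^sup>2)" .
  then show ?thesis by (simp add: L2_norm_def sum_nonneg)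
qed

lemma L2_norm_f_hat_diff_squared:
  assumes "orthonormal_L2 N \<psi>" and h: "\<And>l. h $ l \<in> {0, 1}"
  shows "(L2_norm N (\<lambda>t. f_hat \<psi> h x t - synth \<psi> g t))\<^sup>2
    = (\<Sum>l\<in>UNIV. (1 - h $ l) * (g $ l)\<^sup>2 + h $ l * (x $ l - g $ l)\<^sup>2)"
proof -
  have "(\<lambda>t. f_hat \<psi> h x t - synth \<psi> g t) = synth \<psi> (\<chi> l. h $ l * x $ l - g $ l)"
    by (simp add: f_hat_def synth_def sum_subtractf left_diff_distrib fun_eq_iff)
  then have "(L2_norm N (\<lambda>t. f_hat \<psi> h x t - synth \<psi> g t))\<^sup>2 = (\<Sum>l\<in>UNIV. (h $ l * x $ l - g $ l)\<^sup>2)"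
    using L2_norm_synth_squared[OF assms(1)] by simp
  also have "\<dots> = (\<Sum>l\<in>UNIV. (1 - h $ l) * (g $ l)\<^sup>2 + h $ l * (x $ l - g $ l)\<^sup>2)"
  proof (intro sum.cong refl)
    fix l
    show "(h $ l * x $ l - g $ l)\<^sup>2 = (1 - h $ l) * (g $ l)\<^sup>2 + h $ l * (x $ l - g $ l)\<^sup>2"
      using h[of l] by auto
  qed
  finally show ?thesis .
qed

text \<open>
  The expression under the infimum in the oracle inequality.
\<close>

definition criterion :: "real ^ 'l::finite \<Rightarrow> real ^ 'l \<Rightarrow> real ^ 'l \<Rightarrow> real ^ 'l \<Rightarrow> real" where
  "criterion \<sigma> f x h = (\<Sum>l\<in>UNIV. (1 - h $ l) * (f $ l)\<^sup>2)
     - (\<Sum>l\<in>UNIV. h $ l * ((x $ l)\<^sup>2 - (f $ l)\<^sup>2)) + 2 * Pen \<sigma> h"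

lemma penalized_risk_eq_criterion:
  assumes "orthonormal_L2 N \<psi>" "\<And>l. h $ l \<in> {0, 1}"
  shows "penalized_risk N \<psi> \<sigma> x h
    = criterion \<sigma> f x h + ((\<Sum>l\<in>UNIV. (x $ l)\<^sup>2) - (\<Sum>l\<in>UNIV. (f $ l)\<^sup>2))"
  unfolding penalized_risk_def criterion_def L2_norm_f_hat_diff_squared[OF assms]
  by (simp add: algebra_simps sum_subtractf sum.distrib)

lemma INF_criterion_eq:
  assumes on: "orthonormal_L2 N \<psi>" and H: "H \<subseteq> selection_rules"
    and min: "is_penalized_minimizer N \<psi> \<sigma> H hs"
  shows "(INF h\<in>H. criterion \<sigma> f x (h x)) = criterion \<sigma> f x (hs x)"
proof (rule cInf_eq_minimum)
  have "hs x \<in> (\<lambda>h. h x) ` H" using min by (simp add: is_penalized_minimizer_def)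
  then show "criterion \<sigma> f x (hs x) \<in> (\<lambda>h. criterion \<sigma> f x (h x)) ` H" by force
next
  fix c assume "c \<in> (\<lambda>h. criterion \<sigma> f x (h x)) ` H"
  then obtain h where h: "h \<in> H" "c = criterion \<sigma> f x (h x)" by blast
  have "h x $ l \<in> {0, 1}" "hs x $ l \<in> {0, 1}" for l
    using h(1) H min unfolding is_penalized_minimizer_def selection_rules_def by blast+
  moreover have "penalized_risk N \<psi> \<sigma> x (hs x) \<le> penalized_risk N \<psi> \<sigma> x (h x)"
    using min h(1) by (simp add: is_penalized_minimizer_def)
  ultimately show "criterion \<sigma> f x (hs x) \<le> c"
    using penalized_risk_eq_criterion[OF on, of _ \<sigma> x f] h(2) by simp
qed

text \<open>
  Here \<open>h\<close> is an arbitrary selection and \<open>e\<close> an arbitrary noise vector. Both remainders on the right are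
  free of \<open>h\<close>, so the bound survives the substitution of a selection that depends on the data.
\<close>

lemma loss_le_criterion_plus_remainders:
  fixes f \<sigma> h e :: "real ^ 'l::finite"
  assumes "\<And>l. \<sigma> $ l > 0" and h: "\<And>l. h $ l \<in> {0, 1}" and d: "0 < \<delta>" "\<delta> < 1"
  defines "W \<equiv> joint_excess (threshold CARD('l) (log_plus (real CARD('l) * cov_norm \<sigma>))) (\<lambda>l. (e $ l / \<sigma> $ l)\<^sup>2)"
  shows "(\<Sum>l\<in>UNIV. (1 - h $ l) * (f $ l)\<^sup>2 + h $ l * (e $ l)\<^sup>2)
    \<le> (1 + \<delta>) * criterion \<sigma> f (f + e) h + 4 * cov_norm \<sigma> * W
      + (\<Sum>l\<in>UNIV. coordinate_remainder \<delta> (\<sigma> $ l) (f $ l) (e $ l))"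
proof -
  have \<sigma>: "\<sigma> $ l \<noteq> 0" for l using assms(1)[of l] by simp
  have c: "0 \<le> cov_norm \<sigma>" using cov_norm_upper[of \<sigma>] by (meson order_trans zero_le_power2)
  have W: "0 \<le> W" unfolding W_def by (rule joint_excess_nonneg)
  have "(\<Sum>l\<in>UNIV. h $ l * (e $ l)\<^sup>2) - Pen \<sigma> h \<le> cov_norm \<sigma> * W"
    using noise_minus_Pen_le_joint_excess[OF h, of \<sigma> "\<lambda>l. (e $ l / \<sigma> $ l)\<^sup>2"] \<sigma>
    by (simp add: W_def power_divide)
  then have "2 * (1 + \<delta>) * ((\<Sum>l\<in>UNIV. h $ l * (e $ l)\<^sup>2) - Pen \<sigma> h) \<le> 2 * (1 + \<delta>) * (cov_norm \<sigma> * W)"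
    using d by (intro mult_left_mono) auto
  also have "\<dots> \<le> 4 * (cov_norm \<sigma> * W)"
    using d c W by (intro mult_right_mono) auto
  finally have noise: "2 * (1 + \<delta>) * ((\<Sum>l\<in>UNIV. h $ l * (e $ l)\<^sup>2) - Pen \<sigma> h) \<le> 4 * cov_norm \<sigma> * W"
    by (simp add: mult.assoc)
  have "(\<Sum>l\<in>UNIV. 2 * (1 + \<delta>) * h $ l * f $ l * e $ l - \<delta> * (1 - h $ l) * (f $ l)\<^sup>2 - \<delta> * h $ l * (e $ l)\<^sup>2)
      \<le> (\<Sum>l\<in>UNIV. coordinate_remainder \<delta> (\<sigma> $ l) (f $ l) (e $ l))"
    by (intro sum_mono coordinate_bound d h)
  moreover have "(\<Sum>l\<in>UNIV. (1 - h $ l) * (f $ l)\<^sup>2 + h $ l * (e $ l)\<^sup>2)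
    = (1 + \<delta>) * criterion \<sigma> f (f + e) h + 2 * (1 + \<delta>) * ((\<Sum>l\<in>UNIV. h $ l * (e $ l)\<^sup>2) - Pen \<sigma> h)
      + (\<Sum>l\<in>UNIV. 2 * (1 + \<delta>) * h $ l * f $ l * e $ l - \<delta> * (1 - h $ l) * (f $ l)\<^sup>2 - \<delta> * h $ l * (e $ l)\<^sup>2)"
    unfolding criterion_def
    by (simp add: power2_sum algebra_simps sum.distrib sum_subtractf sum_distrib_left)
  ultimately show ?thesis using noise by linarith
qed

section \<open>Integrability of selected quantities\<close>

lemma borel_measurable_vecI:
  fixes X :: "'a \<Rightarrow> real ^ 'l::finite"
  assumes "\<And>l. (\<lambda>\<omega>. X \<omega> $ l) \<in> borel_measurable M"
  shows "X \<in> borel_measurable M"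
  using assms unfolding borel_measurable_euclidean_space[where f = X]
  by (auto simp: Basis_vec_def inner_axis)

text \<open>
  A measurable selection takes finitely many values, so any function of it is measurable and bounded.
\<close>

lemma integrable_selected_function:
  fixes h :: "'a \<Rightarrow> real ^ 'l::finite" and G :: "real ^ 'l \<Rightarrow> real"
  assumes M: "prob_space M" and h: "h \<in> borel_measurable M" "\<And>\<omega> l. h \<omega> $ l \<in> {0, 1}"
  shows "integrable M (\<lambda>\<omega>. G (h \<omega>))"
proof -
  interpret prob_space M by (rule M)
  let ?V = "{v :: real ^ 'l. \<forall>l. v $ l \<in> {0, 1}}"
  have "?V \<subseteq> vec_lambda ` (UNIV \<rightarrow>\<^sub>E {0, 1})"
  proof
    fix v assume "v \<in> ?V"
    then have "vec_nth v \<in> UNIV \<rightarrow>\<^sub>E {0, 1}" "v = vec_lambda (vec_nth v)" by (auto simp: vec_nth_inverse)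
    then show "v \<in> vec_lambda ` (UNIV \<rightarrow>\<^sub>E {0, 1})" by (metis image_eqI)
  qed
  then have fin: "finite ?V" by (rule finite_subset) (intro finite_imageI finite_PiE; simp)
  have "h \<in> measurable M (count_space ?V)"
    using h by (subst measurable_count_space_eq2[OF fin]) auto
  then have "(\<lambda>\<omega>. G (h \<omega>)) \<in> borel_measurable M" by (rule measurable_compose) simp
  moreover have "\<bar>G (h \<omega>)\<bar> \<le> (\<Sum>v\<in>?V. \<bar>G v\<bar>)" for \<omega>
    using h(2) by (intro member_le_sum[OF _ _ fin]) auto
  ultimately show ?thesis by (intro integrable_const_bound[of _ "\<Sum>v\<in>?V. \<bar>G v\<bar>"]) auto
qed

lemma integrable_times_selection:
  fixes a b :: "'a \<Rightarrow> real"
  assumes "integrable M b" "a \<in> borel_measurable M" "\<And>\<omega>. a \<omega> \<in> {0, 1}"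
  shows "integrable M (\<lambda>\<omega>. a \<omega> * b \<omega>)"
proof (rule Bochner_Integration.integrable_bound[OF assms(1)])
  show "AE \<omega> in M. norm (a \<omega> * b \<omega>) \<le> norm (b \<omega>)"
  proof (intro always_eventually allI)
    fix \<omega>
    show "norm (a \<omega> * b \<omega>) \<le> norm (b \<omega>)" using assms(3)[of \<omega>] by auto
  qed
qed (use assms in measurable)

section \<open>The oracle inequality\<close>

theorem theorem2p2:
  fixes M :: "'a measure" and N :: "'b measure"
    and \<psi> :: "'l::finite \<Rightarrow> 'b \<Rightarrow> real"
    and f \<sigma> :: "real ^ 'l"
    and \<xi> :: "'l \<Rightarrow> 'a \<Rightarrow> real"
    and H :: "(real ^ 'l \<Rightarrow> real ^ 'l) set"
    and hs :: "real ^ 'l \<Rightarrow> real ^ 'l"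
    and \<delta> :: real
  defines "X \<equiv> observation f \<xi>"
  assumes "prob_space M"
    and "\<And>l. \<sigma> $ l > 0"
    and "gaussian_noise M \<sigma> \<xi>"
    and "orthonormal_L2 N \<psi>"
    and "H \<noteq> {}" and "H \<subseteq> selection_rules"
    and "is_penalized_minimizer N \<psi> \<sigma> H hs"
    and "0 < \<delta>" and "\<delta> < 1"
  shows "(\<integral>\<omega>. (L2_norm N (\<lambda>t. f_hat \<psi> (hs (X \<omega>)) (X \<omega>) t - synth \<psi> f t))\<^sup>2 \<partial>M)
    \<le> (1 + \<delta>) *
        (\<integral>\<omega>. (INF h\<in>H.
            (\<Sum>l\<in>UNIV. (1 - h (X \<omega>) $ l) * (f $ l)\<^sup>2)
          - (\<Sum>l\<in>UNIV. h (X \<omega>) $ l * ((X \<omega> $ l)\<^sup>2 - (f $ l)\<^sup>2))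
          + 2 * Pen \<sigma> (h (X \<omega>))) \<partial>M)
      + (4 * sqrt 2 * min (1 / real CARD('l)) (cov_norm \<sigma>)
         + 2 / \<delta> * (\<Sum>l\<in>UNIV. min ((f $ l)\<^sup>2) ((\<sigma> $ l)\<^sup>2)))"
proof -
  interpret prob_space M by (rule \<open>prob_space M\<close>)
  note \<sigma> = \<open>\<And>l. \<sigma> $ l > 0\<close>
  have indep: "indep_vars (\<lambda>_. borel) \<xi> UNIV"
    and dist: "distributed M lborel (\<xi> l) (normal_density 0 (\<sigma> $ l))" for l
    using \<open>gaussian_noise M \<sigma> \<xi>\<close> by (auto simp: gaussian_noise_def)
  have [measurable]: "\<xi> l \<in> borel_measurable M" for l using distributed_measurable[OF dist] by simp
  note moments = normal_moments[OF \<open>prob_space M\<close> \<sigma> dist]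
  have X: "X \<omega> $ l = f $ l + \<xi> l \<omega>" for \<omega> l by (simp add: X_def observation_def)
  have [measurable]: "X \<in> borel_measurable M"
    by (rule borel_measurable_vecI) (simp add: X)
  have hs: "hs \<in> borel_measurable borel" "hs x $ l \<in> {0, 1}" for x l
    using \<open>is_penalized_minimizer N \<psi> \<sigma> H hs\<close>
    unfolding is_penalized_minimizer_def selection_rules_def by blast+
  note [measurable] = hs(1)
  have hX: "(\<lambda>\<omega>. hs (X \<omega>)) \<in> borel_measurable M" by measurable
  have hl [measurable]: "(\<lambda>\<omega>. hs (X \<omega>) $ l) \<in> borel_measurable M" for l
    by (rule measurable_compose[OF hX borel_measurable_nth])
  define e where "e \<omega> = (\<chi> l. \<xi> l \<omega>)" for \<omega>
  have Xe: "X \<omega> = f + e \<omega>" for \<omega> by (simp add: X_def observation_def e_def vec_eq_iff)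
  define D where "D = log_plus (real CARD('l) * cov_norm \<sigma>)"
  define W where "W \<omega> = joint_excess (threshold CARD('l) D) (\<lambda>l. (\<xi> l \<omega> / \<sigma> $ l)\<^sup>2)" for \<omega>
  define loss where "loss \<omega> = (\<Sum>l\<in>UNIV. (1 - hs (X \<omega>) $ l) * (f $ l)\<^sup>2 + hs (X \<omega>) $ l * (\<xi> l \<omega>)\<^sup>2)" for \<omega>
  define C where "C \<omega> = criterion \<sigma> f (X \<omega>) (hs (X \<omega>))" for \<omega>
  define R where "R \<omega> = (\<Sum>l\<in>UNIV. coordinate_remainder \<delta> (\<sigma> $ l) (f $ l) (\<xi> l \<omega>))" for \<omega>
  have D: "0 \<le> D" by (simp add: D_def log_plus_def)
  have W_nonneg: "0 \<le> W \<omega>" for \<omega> unfolding W_def by (rule joint_excess_nonneg)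
  have W_meas: "W \<in> borel_measurable M" unfolding W_def joint_excess_def set_excess_def by measurable
  have "distributed M lborel (\<lambda>\<omega>. \<xi> l \<omega> / \<sigma> $ l) std_normal_density" for l
    using normal_standard_normal_convert[OF \<sigma>, of "\<xi> l" 0 l] dist[of l] by simp
  then have W_nn: "(\<integral>\<^sup>+\<omega>. ennreal (W \<omega>) \<partial>M) \<le> ennreal (sqrt 2 * exp (- D))"
    unfolding W_def
    by (intro expected_joint_excess_le \<open>prob_space M\<close> D indep_vars_compose2[OF indep]) auto
  have W_int: "integrable M W"
    using W_nn W_nonneg W_meas
    by (intro integrableI_nonneg) (auto intro: le_less_trans simp: ennreal_less_top)
  have W_exp: "(\<integral>\<omega>. W \<omega> \<partial>M) \<le> sqrt 2 * exp (- D)"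
    using W_nn W_nonneg W_int by (simp add: nn_integral_eq_integral)
  have R_int: "integrable M R"
    unfolding R_def
    by (intro Bochner_Integration.integrable_sum coordinate_remainder_expectation(1)[OF \<open>prob_space M\<close> \<sigma> dist \<open>0 < \<delta>\<close>])
  have R_exp: "(\<integral>\<omega>. R \<omega> \<partial>M) \<le> 2 / \<delta> * (\<Sum>l\<in>UNIV. min ((f $ l)\<^sup>2) ((\<sigma> $ l)\<^sup>2))"
    unfolding R_def sum_distrib_left
    using coordinate_remainder_expectation[OF \<open>prob_space M\<close> \<sigma> dist \<open>0 < \<delta>\<close>]
    by (subst Bochner_Integration.integral_sum) (auto intro: sum_mono)
  have const_int: "integrable M (\<lambda>\<omega>. (1 - hs (X \<omega>) $ l) * (f $ l)\<^sup>2)" for l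
    using hs(2) by (intro integrable_times_selection) auto
  have loss_int: "integrable M loss"
    unfolding loss_def using hs(2) moments const_int
    by (intro Bochner_Integration.integrable_sum Bochner_Integration.integrable_add integrable_times_selection) auto
  have X_sq: "integrable M (\<lambda>\<omega>. (X \<omega> $ l)\<^sup>2)" for l
    using moments by (simp add: X power2_sum)
  have C_int: "integrable M C"
  proof -
    have "integrable M (\<lambda>\<omega>. Pen \<sigma> (hs (X \<omega>)))"
      by (rule integrable_selected_function[OF \<open>prob_space M\<close> hX hs(2)])
    moreover have "integrable M (\<lambda>\<omega>. hs (X \<omega>) $ l * ((X \<omega> $ l)\<^sup>2 - (f $ l)\<^sup>2))" for l
      using X_sq hl hs(2) by (intro integrable_times_selection Bochner_Integration.integrable_diff) auto
    ultimately show ?thesis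
      unfolding C_def criterion_def using const_int by simp
  qed
  have pointwise: "loss \<omega> \<le> (1 + \<delta>) * C \<omega> + 4 * cov_norm \<sigma> * W \<omega> + R \<omega>" for \<omega>
    using loss_le_criterion_plus_remainders[of \<sigma> "hs (X \<omega>)" \<delta> f "e \<omega>"] \<sigma> hs(2) \<open>0 < \<delta>\<close> \<open>\<delta> < 1\<close>
    unfolding loss_def C_def W_def R_def D_def Xe[symmetric] by (simp add: e_def)
  have c: "0 \<le> cov_norm \<sigma>" using cov_norm_upper[of \<sigma>] by (meson order_trans zero_le_power2)
  have "(\<integral>\<omega>. (L2_norm N (\<lambda>t. f_hat \<psi> (hs (X \<omega>)) (X \<omega>) t - synth \<psi> f t))\<^sup>2 \<partial>M) = (\<integral>\<omega>. loss \<omega> \<partial>M)"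
    unfolding loss_def L2_norm_f_hat_diff_squared[OF \<open>orthonormal_L2 N \<psi>\<close> hs(2)] by (simp add: X)
  also have "\<dots> \<le> (\<integral>\<omega>. (1 + \<delta>) * C \<omega> + 4 * cov_norm \<sigma> * W \<omega> + R \<omega> \<partial>M)"
    using loss_int C_int W_int R_int pointwise by (intro integral_mono) auto
  also have "\<dots> = (1 + \<delta>) * (\<integral>\<omega>. C \<omega> \<partial>M) + 4 * cov_norm \<sigma> * (\<integral>\<omega>. W \<omega> \<partial>M) + (\<integral>\<omega>. R \<omega> \<partial>M)"
    using C_int W_int R_int by simp
  also have "4 * cov_norm \<sigma> * (\<integral>\<omega>. W \<omega> \<partial>M) \<le> 4 * cov_norm \<sigma> * (sqrt 2 * exp (- D))"
    using W_exp c by (intro mult_left_mono) auto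
  also have "\<dots> = 4 * sqrt 2 * (cov_norm \<sigma> * exp (- D))" by simp
  also have "\<dots> \<le> 4 * sqrt 2 * min (1 / real CARD('l)) (cov_norm \<sigma>)"
    unfolding D_def by (intro mult_left_mono cov_norm_times_exp_log_plus_le \<sigma>) auto
  also note R_exp
  also have "(\<integral>\<omega>. C \<omega> \<partial>M) = (\<integral>\<omega>. (INF h\<in>H.
            (\<Sum>l\<in>UNIV. (1 - h (X \<omega>) $ l) * (f $ l)\<^sup>2)
          - (\<Sum>l\<in>UNIV. h (X \<omega>) $ l * ((X \<omega> $ l)\<^sup>2 - (f $ l)\<^sup>2))
          + 2 * Pen \<sigma> (h (X \<omega>))) \<partial>M)"
    unfolding C_def
    INF_criterion_eq[OF \<open>orthonormal_L2 N \<psi>\<close> \<open>H \<subseteq> selection_rules\<close> \<open>is_penalized_minimizer N \<psi> \<sigma> H hs\<close>, symmetric]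
    unfolding criterion_def ..
  finally show ?thesis by (simp add: add.assoc)
qed

end
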